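(* For every $0<\alpha<1$ there is $\tau_0>0$, and for every $0<\tau\le\tau_0$ there is $\nu_0>0$, such that for every $0<\nu\le\nu_0$ and every $\eta>0$ there exist $\gamma=\gamma(\alpha,\nu,\tau,\eta)>0$ and $n_0$ with the following property. For every integer $n\ge n_0$, if $G$ is an oriented graph on $n$ vertices such that for every vertex $v$ both $d^+(v)$ and $d^-(v)$ lie in $((\alpha-\gamma)n,(\alpha+\gamma)n)$, and $G$ is a robust $(\nu,\tau)$-outexpander, then $G$ contains an $(\alpha-\eta)n$-factor.
   Context: An oriented graph is a digraph obtained by orienting the edges of a simple graph. $d^+(v)$, $d^-(v)$ are out- and in-degrees. For an oriented graph $G$ of order $n$ and $S\subseteq V(G)$, the $\nu$-robust outneighborhood $RN^+_{\nu,G}(S)$ is the set of vertices having at least $\nu n$ inneighbors in $S$; $G$ is a robust $(\nu,\tau)$-outexpander if $|RN^+_{\nu,G}(S)|\geq |S|+\nu n$ for every $S\subseteq V(G)$ with $\tau n\leq|S|\leq(1-\tau)n$. An $r$-factor of a digraph is a spanning subdigraph in which every vertex has in-degree and out-degree exactly $r$ ($(\alpha-\eta)n$ is taken to be an integer). *)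

theory Defs
  imports Complex_Main "Graph_Theory.Digraph_Component"
begin

text \<open>
  A simple graph is a finite symmetric loop-free digraph, that is \<^locale>\<open>pair_graph\<close>:
  the edge \<open>uv\<close> is the pair of arcs \<open>(u, v)\<close> and \<open>(v, u)\<close>. Orienting it keeps exactly one of the two.
\<close>

definition orientation_of :: "'a pair_pre_digraph \<Rightarrow> 'a pair_pre_digraph \<Rightarrow> bool" where
  "orientation_of G K \<longleftrightarrow>
     pverts G = pverts K \<and> parcs G \<subseteq> parcs K \<and>
     (\<forall>u v. (u, v) \<in> parcs K \<longrightarrow> ((u, v) \<in> parcs G \<longleftrightarrow> (v, u) \<notin> parcs G))"

definition oriented_graph :: "'a pair_pre_digraph \<Rightarrow> bool" where
  "oriented_graph G \<longleftrightarrow> (\<exists>K. pair_graph K \<and> orientation_of G K)"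

lemma oriented_graph_iff:
  "oriented_graph G \<longleftrightarrow> pair_fin_digraph G \<and> asym (parcs G)"
proof
  assume "oriented_graph G"
  then obtain K where K: "pair_graph K" and o: "orientation_of G K"
    by (auto simp: oriented_graph_def)
  interpret K: pair_graph K by fact
  have "pair_fin_digraph G"
  proof
    fix e assume "e \<in> parcs G"
    then have "e \<in> parcs K" using o by (auto simp: orientation_of_def)
    then show "fst e \<in> pverts G" "snd e \<in> pverts G"
      using o K.arc_fst_in_verts K.arc_snd_in_verts by (auto simp: orientation_of_def)
  next
    show "finite (pverts G)" "finite (parcs G)"
      using o K.pair_finite_verts K.pair_finite_arcs
      by (auto simp: orientation_of_def intro: finite_subset)
  qed
  moreover have "asym (parcs G)"
    using o by (intro asymI) (auto simp: orientation_of_def)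
  ultimately show "pair_fin_digraph G \<and> asym (parcs G)" ..
next
  assume *: "pair_fin_digraph G \<and> asym (parcs G)"
  then interpret G: pair_fin_digraph G by simp
  from * have asym: "asym (parcs G)" ..
  define K where "K = \<lparr>pverts = pverts G, parcs = parcs G \<union> (parcs G)\<inverse>\<rparr>"
  have "pair_graph K"
  proof
    show "finite (pverts K)" "finite (parcs K)"
      using G.pair_finite_verts G.pair_finite_arcs by (auto simp: K_def)
    show "symmetric (with_proj K)"
      by (auto simp: symmetric_def K_def sym_def)
  next
    fix e assume e: "e \<in> parcs K"
    then show "fst e \<in> pverts K" "snd e \<in> pverts K"
      using G.arc_fst_in_verts G.arc_snd_in_verts by (force simp: K_def)+
    from e show "fst e \<noteq> snd e"
      using asym by (cases e) (auto simp: K_def dest: asymD)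
  qed
  moreover have "orientation_of G K"
    using asym by (auto simp: orientation_of_def K_def dest: asymD)
  ultimately show "oriented_graph G"
    by (auto simp: oriented_graph_def)
qed

definition robust_outneighborhood :: "real \<Rightarrow> 'a pair_pre_digraph \<Rightarrow> 'a set \<Rightarrow> 'a set" where
  "robust_outneighborhood \<nu> G S =
     {v \<in> pverts G. \<nu> * real (card (pverts G)) \<le> real (card {u \<in> S. (u, v) \<in> parcs G})}"

definition robust_outexpander :: "real \<Rightarrow> real \<Rightarrow> 'a pair_pre_digraph \<Rightarrow> bool" where
  "robust_outexpander \<nu> \<tau> G \<longleftrightarrow>
     (\<forall>S \<subseteq> pverts G.
        \<tau> * real (card (pverts G)) \<le> real (card S) \<and>
        real (card S) \<le> (1 - \<tau>) * real (card (pverts G)) \<longrightarrow>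
        real (card (robust_outneighborhood \<nu> G S)) \<ge> real (card S) + \<nu> * real (card (pverts G)))"

definition factor_of :: "nat \<Rightarrow> 'a pair_pre_digraph \<Rightarrow> 'a pair_pre_digraph \<Rightarrow> bool" where
  "factor_of r H G \<longleftrightarrow>
     spanning (with_proj H) (with_proj G) \<and>
     (\<forall>v \<in> pverts H. in_degree (with_proj H) v = r \<and> out_degree (with_proj H) v = r)"

end

theory Submission
  imports Defs
begin

text \<open>
  Splitting every vertex into an out-copy and an in-copy turns an \<open>r\<close>-factor into a subgraph of a
  bipartite graph with all degrees \<open>r\<close>. By the cut criterion for bipartite degree-constrained
  subgraphs, it suffices that at least \<open>r (|X| - |Y|)\<close> arcs go from \<open>X\<close> to the complement of \<open>Y\<close>,
  for all vertex sets \<open>X\<close> and \<open>Y\<close>. If \<open>|X| - |Y|\<close> is not tiny, this follows from the almost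
  regularity alone, because \<open>\<gamma>\<close> is small compared with \<open>\<eta>\<close>. Otherwise \<open>X\<close> and \<open>Y\<close> have almost the
  same size: if that size is at least \<open>\<tau> n\<close> and at most \<open>(1 - \<tau>) n\<close>, robust expansion provides
  \<open>\<nu>\<^sup>2 n\<^sup>2\<close> arcs, and if \<open>X\<close> or the complement of \<open>Y\<close> is small, a degree count suffices.
\<close>

section \<open>The cut criterion for bipartite degree-constrained subgraphs\<close>

text \<open>Inclusion-exclusion on both sides: an arc counted by \<open>?R\<close> or
  \<open>?S\<close> is counted by \<open>?P\<close> or \<open>?Q\<close>, and one counted by both
  \<open>?R\<close> and \<open>?S\<close> is counted by both \<open>?P\<close> and
  \<open>?Q\<close>.\<close>

lemma card_arcs_submodular:
  fixes E :: "('a \<times> 'b) set"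
  assumes "finite E"
  shows "card (E \<inter> (X \<union> X') \<times> (B - (Y \<union> Y'))) + card (E \<inter> (X \<inter> X') \<times> (B - (Y \<inter> Y')))
    \<le> card (E \<inter> X \<times> (B - Y)) + card (E \<inter> X' \<times> (B - Y'))"
    (is "card ?R + card ?S \<le> card ?P + card ?Q")
proof -
  have "card ?R + card ?S = card (?R \<union> ?S) + card (?R \<inter> ?S)"
    using assms by (intro card_Un_Int) auto
  also have "\<dots> \<le> card (?P \<union> ?Q) + card (?P \<inter> ?Q)"
    using assms by (intro add_mono card_mono) auto
  also have "\<dots> = card ?P + card ?Q"
    using assms by (intro card_Un_Int[symmetric]) auto
  finally show ?thesis .
qed

text \<open>
  The demands \<open>f\<close> and \<open>g\<close> are integers, not naturals, so that in the induction an arc can be used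
  without knowing that the demands at its ends are positive. An arc \<open>(a, b)\<close> can be neither
  deleted nor used only if there are two tight pairs \<open>(X, Y)\<close> and \<open>(X', Y')\<close> with \<open>a\<close> in \<open>X\<close> only and
  \<open>b\<close> in \<open>Y'\<close> only; then \<open>(a, b)\<close> makes submodularity strict, which is impossible for tight pairs.
\<close>

theorem bipartite_degree_subgraph:
  fixes E :: "('a \<times> 'b) set" and f :: "'a \<Rightarrow> int" and g :: "'b \<Rightarrow> int"
  assumes "finite A" "finite B" "finite E" "E \<subseteq> A \<times> B"
    and "sum f A = sum g B"
    and "\<And>X Y. X \<subseteq> A \<Longrightarrow> Y \<subseteq> B \<Longrightarrow> sum f X \<le> sum g Y + int (card (E \<inter> X \<times> (B - Y)))"
  shows "\<exists>F \<subseteq> E. (\<forall>a \<in> A. int (card (F `` {a})) = f a) \<and> (\<forall>b \<in> B. int (card (F\<inverse> `` {b})) = g b)"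
  using assms(3-)
proof (induction E arbitrary: f g rule: finite_induct)
  case empty
  \<comment> \<open>Without arcs, the cut condition at singletons fixes the signs of the demands,
    and the equal sums then force every demand to be 0.\<close>
  have g: "0 \<le> g b" if "b \<in> B" for b
    using empty.prems(3)[of "{}" "{b}"] that by simp
  have f: "f a \<le> 0" if "a \<in> A" for a
    using empty.prems(3)[of "{a}" "{}"] that by simp
  have "sum f A \<le> 0" "0 \<le> sum g B"
    using f g by (auto intro: sum_nonpos sum_nonneg)
  then have "sum f A = 0" "sum g B = 0"
    using empty.prems(2) by auto
  then have "\<forall>b\<in>B. g b = 0" "\<forall>a\<in>A. f a = 0"
    using sum_nonneg_eq_0_iff[OF \<open>finite B\<close>, of g] sum_nonneg_eq_0_iff[OF \<open>finite A\<close>, of "\<lambda>a. - f a"] f g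
    by (auto simp: sum_negf)
  then show ?case by auto
next
  case (insert e E)
  obtain a b where e: "e = (a, b)" by (cases e)
  have ab: "a \<in> A" "b \<in> B" and EAB: "E \<subseteq> A \<times> B" and eE: "(a, b) \<notin> E"
    using insert.prems(1) insert.hyps(2) by (auto simp: e)
  \<comment> \<open>The slack of the cut condition after deleting \<open>e\<close>. Restoring
    \<open>e\<close> raises it by one exactly when \<open>e\<close> leads from \<open>X\<close> to
    the complement of \<open>Y\<close>.\<close>
  define \<phi> where "\<phi> X Y = sum g Y + int (card (E \<inter> X \<times> (B - Y))) - sum f X" for X Y
  have cut: "0 \<le> \<phi> X Y + (if a \<in> X \<and> b \<notin> Y then 1 else 0)" if "X \<subseteq> A" "Y \<subseteq> B" for X Y
  proof -
    have "insert e E \<inter> X \<times> (B - Y) =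
        (if a \<in> X \<and> b \<notin> Y then insert e (E \<inter> X \<times> (B - Y)) else E \<inter> X \<times> (B - Y))"
      using ab by (auto simp: e)
    then show ?thesis
      using insert.prems(3)[OF that] insert.hyps by (simp add: \<phi>_def split: if_splits)
  qed
  have submod: "\<phi> (X \<union> X') (Y \<union> Y') + \<phi> (X \<inter> X') (Y \<inter> Y') \<le> \<phi> X Y + \<phi> X' Y'"
    if "X \<subseteq> A" "X' \<subseteq> A" "Y \<subseteq> B" "Y' \<subseteq> B" for X X' Y Y'
  proof -
    have "finite X" "finite X'" "finite Y" "finite Y'"
      using that by (auto intro: finite_subset[OF _ assms(1)] finite_subset[OF _ assms(2)])
    then have "sum f (X \<union> X') + sum f (X \<inter> X') = sum f X + sum f X'"
      "sum g (Y \<union> Y') + sum g (Y \<inter> Y') = sum g Y + sum g Y'"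
      by (simp_all add: sum.union_inter)
    then show ?thesis
      using card_arcs_submodular[OF insert.hyps(1), of X X' B Y Y'] by (simp add: \<phi>_def)
  qed
  show ?case
  proof (cases "\<forall>X Y. X \<subseteq> A \<longrightarrow> Y \<subseteq> B \<longrightarrow> 0 \<le> \<phi> X Y")
    case True
    then have "\<exists>F \<subseteq> E. (\<forall>a \<in> A. int (card (F `` {a})) = f a) \<and> (\<forall>b \<in> B. int (card (F\<inverse> `` {b})) = g b)"
      by (intro insert.IH EAB insert.prems(2)) (simp add: \<phi>_def)
    then show ?thesis by blast
  next
    case False
    \<comment> \<open>Deleting \<open>e\<close> violates the condition at this pair, so
      \<open>e\<close> must cross it. Hence \<open>e\<close> is used, and the demands at both its
      ends drop by one.\<close>
    then obtain X Y where XY: "X \<subseteq> A" "Y \<subseteq> B" "\<phi> X Y < 0"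
      by (auto simp: not_le)
    with cut[of X Y] have aX: "a \<in> X" and bY: "b \<notin> Y"
      by (auto split: if_splits)
    let ?f = "\<lambda>x. f x - (if x = a then 1 else 0)" and ?g = "\<lambda>y. g y - (if y = b then 1 else 0)"
    have sumf: "sum ?f X' = sum f X' - (if a \<in> X' then 1 else 0)" if "X' \<subseteq> A" for X'
      using finite_subset[OF that \<open>finite A\<close>] by (simp add: sum_subtractf)
    have sumg: "sum ?g Y' = sum g Y' - (if b \<in> Y' then 1 else 0)" if "Y' \<subseteq> B" for Y'
      using finite_subset[OF that \<open>finite B\<close>] by (simp add: sum_subtractf)
    have "\<exists>F \<subseteq> E. (\<forall>x \<in> A. int (card (F `` {x})) = ?f x) \<and> (\<forall>y \<in> B. int (card (F\<inverse> `` {y})) = ?g y)"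
    proof (intro insert.IH EAB)
      show "sum ?f A = sum ?g B"
        using ab insert.prems(2) by (simp add: sumf sumg)
    next
      fix X' Y' assume *: "X' \<subseteq> A" "Y' \<subseteq> B"
      have "0 \<le> \<phi> X' Y'" if "a \<notin> X'" using cut[OF *] that by simp
      \<comment> \<open>The union has \<open>b\<close> in its second set and the intersection lacks
        \<open>a\<close> in its first, so \<open>e\<close> crosses neither pair and both have
        nonnegative slack. Submodularity and \<open>\<phi> X Y < 0\<close> then make
        \<open>\<phi> X' Y'\<close> positive.\<close>
      moreover have "0 < \<phi> X' Y'" if "a \<notin> X'" "b \<in> Y'"
        using submod[OF XY(1) *(1) XY(2) *(2)] XY(3) aX bY that
          cut[of "X \<union> X'" "Y \<union> Y'"] cut[of "X \<inter> X'" "Y \<inter> Y'"] XY(1,2) *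
        by (simp add: le_infI1)
      ultimately have "0 \<le> \<phi> X' Y' - (if b \<in> Y' then 1 else 0) + (if a \<in> X' then 1 else 0)"
        using cut[OF *] by (auto split: if_splits)
      then show "sum ?f X' \<le> sum ?g Y' + int (card (E \<inter> X' \<times> (B - Y')))"
        using * by (simp add: sumf sumg \<phi>_def)
    qed
    then obtain F where F: "F \<subseteq> E" "\<forall>x \<in> A. int (card (F `` {x})) = ?f x"
        "\<forall>y \<in> B. int (card (F\<inverse> `` {y})) = ?g y" by blast
    have fin: "finite F" and "(a, b) \<notin> F" using F(1) insert.hyps eE finite_subset by auto
    have "insert e F `` {x} = (if x = a then insert b (F `` {x}) else F `` {x})" for x
      by (auto simp: e)
    moreover have "(insert e F)\<inverse> `` {y} = (if y = b then insert a (F\<inverse> `` {y}) else F\<inverse> `` {y})" for y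
      by (auto simp: e)
    moreover have "finite (F `` {x})" "finite (F\<inverse> `` {y})" for x y
      using fin by (auto intro: finite_Image)
    ultimately have "\<forall>x \<in> A. int (card (insert e F `` {x})) = f x"
      "\<forall>y \<in> B. int (card ((insert e F)\<inverse> `` {y})) = g y"
      using F(2,3) \<open>(a, b) \<notin> F\<close> by auto
    with F(1) show ?thesis by (intro exI[of _ "insert e F"]) auto
  qed
qed

section \<open>Counting arcs between vertex sets\<close>

lemma card_arcs_eq_sum:
  assumes "finite E" "finite X"
  shows "card (E \<inter> X \<times> Y) = (\<Sum>x\<in>X. card (E `` {x} \<inter> Y))"
proof -
  have "E \<inter> X \<times> Y = Sigma X (\<lambda>x. E `` {x} \<inter> Y)" by auto
  then show ?thesis using assms by (simp add: card_SigmaI finite_Image)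
qed

lemma card_arcs_converse: "card (E\<inverse> \<inter> Y \<times> X) = card (E \<inter> X \<times> Y)"
proof -
  have "E\<inverse> \<inter> Y \<times> X = (E \<inter> X \<times> Y)\<inverse>" by auto
  then show ?thesis by (metis card_inverse)
qed

lemma card_arcs_le_mult:
  assumes "finite X" "finite Y"
  shows "card (E \<inter> X \<times> Y) \<le> card X * card Y"
  using card_mono[of "X \<times> Y" "E \<inter> X \<times> Y"] assms by (simp add: card_cartesian_product)

lemma card_arcs_diff:
  assumes "finite E" "Y \<subseteq> V"
  shows "card (E \<inter> X \<times> V) = card (E \<inter> X \<times> Y) + card (E \<inter> X \<times> (V - Y))"
proof -
  have "E \<inter> X \<times> V = (E \<inter> X \<times> Y) \<union> (E \<inter> X \<times> (V - Y))" using assms(2) by auto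
  then show ?thesis using assms(1) by (simp add: card_Un_disjoint disjoint_iff)
qed

text \<open>Hypothesis \<open>m\<close> is a degree count: of the arcs leaving a set of size
  \<open>x\<close>, at most \<open>x * y\<close> end in a set of size \<open>y\<close>. The surplus
  over \<open>r * (x - y)\<close> is \<open>(\<eta> - \<gamma>) * n * x + y * (r - x)\<close>, whose
  second term is negative only if \<open>r < x\<close>; then \<open>r\<close> is small, so
  \<open>\<eta>\<close> is large and the first term dominates.\<close>

lemma small_set_bound:
  fixes n x y r m \<alpha> \<gamma> \<eta> \<tau> :: real
  assumes "0 < n" "0 \<le> y" "y \<le> x" "x \<le> 2 * \<tau> * n" "0 \<le> r" "r = (\<alpha> - \<eta>) * n"
    and "8 * \<tau> \<le> \<alpha>" "2 * \<gamma> \<le> \<alpha>" "\<gamma> \<le> \<eta>"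
    and m: "(\<alpha> - \<gamma>) * n * x - x * y \<le> m"
  shows "r * (x - y) \<le> m"
proof -
  have eq: "(\<alpha> - \<gamma>) * n * x - x * y - r * (x - y) = (\<eta> - \<gamma>) * n * x + y * (r - x)"
    unfolding assms(6) by (simp add: algebra_simps)
  have "0 \<le> (\<eta> - \<gamma>) * n * x + y * (r - x)"
  proof (cases "x \<le> r")
    case True
    then show ?thesis using assms by simp
  next
    case False
    have "y * (x - r) \<le> x * x"
      using False assms by (intro mult_mono) auto
    moreover have "(\<alpha> - \<eta>) * n < 2 * \<tau> * n" using False assms by linarith
    then have "\<alpha> - \<eta> < 2 * \<tau>" using \<open>0 < n\<close> by simp
    \<comment> \<open>From \<open>\<eta> > \<alpha> - 2 * \<tau>\<close> and
      \<open>\<gamma> \<le> \<alpha> / 2\<close> follows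
      \<open>\<eta> - \<gamma> > \<alpha> / 2 - 2 * \<tau>\<close>, and
      \<open>8 * \<tau> \<le> \<alpha>\<close> makes this at least
      \<open>2 * \<tau>\<close>.\<close>
    then have "2 * \<tau> * n \<le> (\<eta> - \<gamma>) * n" using assms by (intro mult_right_mono) auto
    then have "x * x \<le> (\<eta> - \<gamma>) * n * x"
      using assms(2-4) by (intro mult_right_mono) linarith+
    ultimately show ?thesis by (simp add: algebra_simps)
  qed
  then show ?thesis using eq m by linarith
qed

section \<open>The cut condition in almost regular robust outexpanders\<close>

lemma robust_outexpander_cut:
  fixes G :: "'a pair_pre_digraph" and \<alpha> \<gamma> \<eta> \<nu> \<tau> :: real
  defines "V \<equiv> pverts G" and "E \<equiv> parcs G"
  defines "n \<equiv> real (card V)"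
  assumes "finite V" "finite E" "0 < n"
    and outd: "\<And>v. v \<in> V \<Longrightarrow> (\<alpha> - \<gamma>) * n \<le> card (E `` {v} \<inter> V)"
    and ind_ge: "\<And>v. v \<in> V \<Longrightarrow> (\<alpha> - \<gamma>) * n \<le> card (E\<inverse> `` {v} \<inter> V)"
    and ind_le: "\<And>v. v \<in> V \<Longrightarrow> card (E\<inverse> `` {v} \<inter> V) \<le> (\<alpha> + \<gamma>) * n"
    and rob: "robust_outexpander \<nu> \<tau> G"
    and r: "0 \<le> r" "r = (\<alpha> - \<eta>) * n"
    and c: "\<alpha> < 1" "0 < \<eta>" "0 < \<nu>" "8 * \<tau> \<le> \<alpha>" "0 < \<gamma>" "2 * \<gamma> \<le> \<alpha>" "\<gamma> \<le> \<eta>"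
      "2 * \<gamma> \<le> \<eta> * \<nu>\<^sup>2" "2 * \<gamma> \<le> \<eta> * \<tau>"
    and XV: "X \<subseteq> V" and YV: "Y \<subseteq> V"
  shows "r * (real (card X) - real (card Y)) \<le> card (E \<inter> X \<times> (V - Y))"
proof -
  define x y where "x = real (card X)" and "y = real (card Y)"
  define m where "m = real (card (E \<inter> X \<times> (V - Y)))"
  have fin: "finite X" "finite Y" "finite (E\<inverse>)"
    using XV YV \<open>finite V\<close> \<open>finite E\<close> finite_subset by auto
  have le: "0 \<le> x" "0 \<le> y" "x \<le> n" "y \<le> n"
    using XV YV \<open>finite V\<close> by (auto simp: x_def y_def n_def intro: card_mono)
  have compl: "real (card (V - S)) = n - card S" if "S \<subseteq> V" for S
    using that \<open>finite V\<close> by (simp add: n_def card_Diff_subset finite_subset of_nat_diff card_mono)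
  have split: "real (card (E \<inter> X \<times> V)) = card (E \<inter> X \<times> Y) + m"
    using card_arcs_diff[OF \<open>finite E\<close> YV, of X] by (simp add: m_def)
  have "(\<Sum>v\<in>X. (\<alpha> - \<gamma>) * n) \<le> (\<Sum>v\<in>X. real (card (E `` {v} \<inter> V)))"
    using outd XV by (intro sum_mono) auto
  then have out: "(\<alpha> - \<gamma>) * n * x \<le> card (E \<inter> X \<times> V)"
    using fin \<open>finite E\<close> by (simp add: card_arcs_eq_sum x_def mult.commute)
  have "r * (x - y) \<le> m"
  proof -
    \<comment> \<open>Near regularity alone gives a surplus of at least
      \<open>n * (\<eta> * (x - y) - \<gamma> * (x + y))\<close> arcs. Since
      \<open>x + y \<le> 2 * n\<close>, the threshold \<open>2 * \<gamma> * n\<close> makes it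
      nonnegative.\<close>
    consider "x \<le> y" | "2 * \<gamma> * n \<le> \<eta> * (x - y)" | "y < x" "\<eta> * (x - y) < 2 * \<gamma> * n"
      by linarith
    then show ?thesis
    proof cases
      case 1
      then have "r * (x - y) \<le> 0" using r(1) by (simp add: mult_nonneg_nonpos)
      then show ?thesis by (simp add: m_def)
    next
      case 2
      have "real (card (E \<inter> X \<times> Y)) \<le> card (E \<inter> V \<times> Y)"
        using XV \<open>finite E\<close> by (auto intro: card_mono)
      also have "\<dots> = card (E\<inverse> \<inter> Y \<times> V)" by (simp add: card_arcs_converse)
      also have "\<dots> = (\<Sum>v\<in>Y. real (card (E\<inverse> `` {v} \<inter> V)))"
        using fin by (simp add: card_arcs_eq_sum)
      also have "\<dots> \<le> (\<Sum>v\<in>Y. (\<alpha> + \<gamma>) * n)"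
        using ind_le YV by (intro sum_mono) auto
      also have "\<dots> = (\<alpha> + \<gamma>) * n * y" by (simp add: y_def)
      finally have "(\<alpha> - \<gamma>) * n * x - (\<alpha> + \<gamma>) * n * y \<le> m" using split out by linarith
      moreover have "(\<alpha> - \<gamma>) * n * x - (\<alpha> + \<gamma>) * n * y - r * (x - y)
          = n * (\<eta> * (x - y) - \<gamma> * (x + y))"
        by (simp add: r(2) algebra_simps)
      moreover have "\<gamma> * (x + y) \<le> \<gamma> * (2 * n)"
        using le c by (intro mult_left_mono) auto
      then have "0 \<le> n * (\<eta> * (x - y) - \<gamma> * (x + y))"
        using 2 \<open>0 < n\<close> by (intro mult_nonneg_nonneg) auto
      ultimately show ?thesis by linarith
    next
      case 3
      have "2 * \<gamma> * n \<le> \<eta> * \<tau> * n" using c(9) \<open>0 < n\<close> by simp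
      then have "\<eta> * (x - y) < \<eta> * (\<tau> * n)"
        using 3(2) unfolding mult.assoc by linarith
      then have close: "x - y < \<tau> * n" using \<open>0 < \<eta>\<close> by simp
      consider "x < \<tau> * n" | "(1 - \<tau>) * n < x" | "\<tau> * n \<le> x" "x \<le> (1 - \<tau>) * n"
        by linarith
      then show ?thesis
      proof cases
        case 1
        have "real (card (E \<inter> X \<times> Y)) \<le> x * y"
          using card_arcs_le_mult[OF fin(1,2), of E] unfolding x_def y_def
          by (metis of_nat_le_iff of_nat_mult)
        then have "(\<alpha> - \<gamma>) * n * x - x * y \<le> m" using split out by linarith
        then show ?thesis
          using 1 3 le r c \<open>0 < n\<close> by (intro small_set_bound[of n y x \<tau> r \<alpha> \<eta> \<gamma> m]) auto
      next
        case 2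
        \<comment> \<open>Reversing all arcs replaces \<open>X\<close> and \<open>Y\<close> by
          \<open>V - Y\<close> and \<open>V - X\<close>, with \<open>z - w = x - y\<close>. As
          \<open>w\<close> and \<open>x - y\<close> are both below \<open>\<tau> * n\<close>,
          \<open>z\<close> is below \<open>2 * \<tau> * n\<close>; this explains the factor 2 in
          \<open>small_set_bound\<close>.\<close>
        define z w where "z = n - y" and "w = n - x"
        have zw: "real (card (V - Y)) = z" "real (card (V - X)) = w"
          using XV YV by (auto simp: compl z_def w_def x_def y_def)
        have finZ: "finite (V - Y)" "finite (V - X)" using \<open>finite V\<close> by auto
        have "(\<Sum>v\<in>V - Y. (\<alpha> - \<gamma>) * n) \<le> (\<Sum>v\<in>V - Y. real (card (E\<inverse> `` {v} \<inter> V)))"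
          using ind_ge by (intro sum_mono) auto
        also have "\<dots> = card (E\<inverse> \<inter> (V - Y) \<times> V)"
          using fin finZ by (simp add: card_arcs_eq_sum)
        also have "\<dots> = card (E\<inverse> \<inter> (V - Y) \<times> X) + card (E\<inverse> \<inter> (V - Y) \<times> (V - X))"
          using card_arcs_diff[OF fin(3) XV, of "V - Y"] by simp
        finally have "(\<alpha> - \<gamma>) * n * z \<le> m + card (E\<inverse> \<inter> (V - Y) \<times> (V - X))"
          using zw(1) by (simp add: m_def card_arcs_converse mult.commute)
        moreover have "real (card (E\<inverse> \<inter> (V - Y) \<times> (V - X))) \<le> z * w"
          using card_arcs_le_mult[OF finZ, of "E\<inverse>"] zw by (metis of_nat_le_iff of_nat_mult)
        ultimately have "(\<alpha> - \<gamma>) * n * z - z * w \<le> m" by linarith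
        moreover have "w \<le> z" "0 \<le> w" "z \<le> 2 * \<tau> * n"
          using 2 3(1) close le by (auto simp: z_def w_def algebra_simps)
        ultimately have "r * (z - w) \<le> m"
          using r c \<open>0 < n\<close> by (intro small_set_bound[of n w z \<tau> r \<alpha> \<eta> \<gamma> m]) auto
        then show ?thesis by (simp add: z_def w_def)
      next
        case 3
        define R where "R = robust_outneighborhood \<nu> G X"
        have "R \<subseteq> V" by (auto simp: R_def robust_outneighborhood_def V_def)
        then have "finite R" using \<open>finite V\<close> finite_subset by auto
        \<comment> \<open>Since \<open>y < x\<close>, at least \<open>\<nu> * n\<close> vertices of
          \<open>R\<close> lie outside \<open>Y\<close>, and each receives at least
          \<open>\<nu> * n\<close> arcs from \<open>X\<close>.\<close>
        have "x + \<nu> * n \<le> card R"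
          using rob 3 XV by (auto simp: robust_outexpander_def R_def x_def n_def V_def)
        moreover have "card R \<le> card (R - Y) + card Y"
          using card_mono[of "(R - Y) \<union> Y" R] card_Un_le[of "R - Y" Y] \<open>finite R\<close> fin by auto
        ultimately have "\<nu> * n \<le> card (R - Y)"
          using \<open>y < x\<close> by (simp add: y_def)
        then have "\<nu> * n * (\<nu> * n) \<le> card (R - Y) * (\<nu> * n)"
          using \<open>0 < n\<close> c by (intro mult_right_mono) auto
        also have "\<dots> = (\<Sum>v\<in>R - Y. \<nu> * n)" by simp
        also have "\<dots> \<le> (\<Sum>v\<in>R - Y. real (card (E\<inverse> `` {v} \<inter> X)))"
        proof (intro sum_mono)
          fix v assume "v \<in> R - Y"
          moreover have "E\<inverse> `` {v} \<inter> X = {u \<in> X. (u, v) \<in> parcs G}" by (auto simp: E_def)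
          ultimately show "\<nu> * n \<le> card (E\<inverse> `` {v} \<inter> X)"
            by (simp add: R_def robust_outneighborhood_def n_def V_def)
        qed
        also have "\<dots> = card (E\<inverse> \<inter> (R - Y) \<times> X)"
          using fin \<open>finite R\<close> by (simp add: card_arcs_eq_sum)
        also have "\<dots> = card (E \<inter> X \<times> (R - Y))" by (simp add: card_arcs_converse)
        also have "\<dots> \<le> m"
          using \<open>R \<subseteq> V\<close> \<open>finite E\<close> unfolding m_def of_nat_le_iff by (intro card_mono) auto
        finally have m: "\<nu>\<^sup>2 * n * n \<le> m" by (simp add: power2_eq_square mult_ac)
        \<comment> \<open>The choice of \<open>\<gamma>\<close> makes \<open>x - y\<close> at most
          \<open>\<nu>\<^sup>2 * n\<close>, so with \<open>r \<le> n\<close> the arcs just counted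
          suffice.\<close>
        have "2 * \<gamma> * n \<le> \<eta> * \<nu>\<^sup>2 * n" using c(8) \<open>0 < n\<close> by simp
        then have "\<eta> * (x - y) \<le> \<eta> * (\<nu>\<^sup>2 * n)"
          using \<open>\<eta> * (x - y) < 2 * \<gamma> * n\<close> unfolding mult.assoc by linarith
        then have "x - y \<le> \<nu>\<^sup>2 * n" using \<open>0 < \<eta>\<close> by simp
        moreover have "r \<le> n"
          using r(2) c \<open>0 < n\<close> mult_right_mono[of "\<alpha> - \<eta>" 1 n] by simp
        ultimately have "r * (x - y) \<le> n * (\<nu>\<^sup>2 * n)"
          using r(1) \<open>y < x\<close> \<open>0 < n\<close> by (intro mult_mono) auto
        then show ?thesis using m by (simp add: mult_ac)
      qed
    qed
  qed
  then show ?thesis by (simp add: x_def y_def m_def)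
qed

section \<open>From the cut condition to factors\<close>

lemma degree_pair_digraph:
  shows "out_degree (with_proj G) v = card (parcs G `` {v})"
    and "in_degree (with_proj G) v = card ((parcs G)\<inverse> `` {v})"
proof -
  have "out_arcs (with_proj G) v = Pair v ` (parcs G `` {v})"
    by (auto simp: out_arcs_def)
  then show "out_degree (with_proj G) v = card (parcs G `` {v})"
    by (simp add: out_degree_def card_image inj_on_def)
  have "in_arcs (with_proj G) v = (\<lambda>u. (u, v)) ` ((parcs G)\<inverse> `` {v})"
    by (auto simp: in_arcs_def)
  then show "in_degree (with_proj G) v = card ((parcs G)\<inverse> `` {v})"
    by (simp add: in_degree_def card_image inj_on_def)
qed

text \<open>With \<open>pverts G\<close> serving as both sides, \<open>parcs G\<close> itself is the
  bipartite arc set, and the cut criterion with all demands \<open>r\<close> selects the arcs of the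
  factor.\<close>

lemma factor_of_if_cut:
  fixes G :: "'a pair_pre_digraph"
  assumes "pair_fin_digraph G"
    and cut: "\<And>X Y. X \<subseteq> pverts G \<Longrightarrow> Y \<subseteq> pverts G \<Longrightarrow>
      int r * int (card X) \<le> int r * int (card Y) + int (card (parcs G \<inter> X \<times> (pverts G - Y)))"
  shows "\<exists>H. factor_of r H G"
proof -
  interpret pair_fin_digraph G by fact
  have sub: "parcs G \<subseteq> pverts G \<times> pverts G"
    using arc_fst_in_verts arc_snd_in_verts by force
  have "\<exists>F \<subseteq> parcs G. (\<forall>a \<in> pverts G. int (card (F `` {a})) = int r) \<and>
      (\<forall>b \<in> pverts G. int (card (F\<inverse> `` {b})) = int r)"
    using cut sub by (intro bipartite_degree_subgraph) (auto simp: mult.commute)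
  then obtain F where F: "F \<subseteq> parcs G" "\<forall>a \<in> pverts G. card (F `` {a}) = r"
      "\<forall>b \<in> pverts G. card (F\<inverse> `` {b}) = r" by auto
  define H where "H = \<lparr>pverts = pverts G, parcs = F\<rparr>"
  have "wf_digraph (with_proj H)"
    using F(1) sub by unfold_locales (auto simp: H_def)
  then have "spanning (with_proj H) (with_proj G)"
    using F(1) wf_digraph by (auto simp: spanning_def subgraph_def compatible_def H_def)
  then have "factor_of r H G"
    using F(2,3) by (simp add: factor_of_def degree_pair_digraph H_def)
  then show ?thesis ..
qed

theorem theorem2p15:
  shows "\<forall>\<alpha>::real. 0 < \<alpha> \<and> \<alpha> < 1 \<longrightarrow>
    (\<exists>\<tau>\<^sub>0::real. \<tau>\<^sub>0 > 0 \<and> (\<forall>\<tau>::real. 0 < \<tau> \<and> \<tau> \<le> \<tau>\<^sub>0 \<longrightarrow>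
    (\<exists>\<nu>\<^sub>0::real. \<nu>\<^sub>0 > 0 \<and> (\<forall>\<nu>::real. 0 < \<nu> \<and> \<nu> \<le> \<nu>\<^sub>0 \<longrightarrow>
    (\<forall>\<eta>::real. \<eta> > 0 \<longrightarrow>
    (\<exists>\<gamma>::real. \<gamma> > 0 \<and> (\<exists>n\<^sub>0::nat. \<forall>n::nat. n \<ge> n\<^sub>0 \<longrightarrow>
    (\<forall>(G :: 'a pair_pre_digraph) (r::nat).
       oriented_graph G \<and> card (pverts G) = n \<and>
       (\<forall>v \<in> pverts G.
          real (out_degree (with_proj G) v) \<in> {(\<alpha> - \<gamma>) * real n <..< (\<alpha> + \<gamma>) * real n} \<and>
          real (in_degree (with_proj G) v) \<in> {(\<alpha> - \<gamma>) * real n <..< (\<alpha> + \<gamma>) * real n}) \<and>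
       robust_outexpander \<nu> \<tau> G \<and>
       real r = (\<alpha> - \<eta>) * real n \<longrightarrow>
       (\<exists>H :: 'a pair_pre_digraph. factor_of r H G)))))))))"
proof (intro allI impI)
  fix \<alpha> :: real assume \<alpha>: "0 < \<alpha> \<and> \<alpha> < 1"
  \<comment> \<open>Each entry of the minimum defining \<open>\<gamma>\<close> is one upper bound
    required by \<open>robust_outexpander_cut\<close>; \<open>\<alpha> / 8\<close> comes from
    \<open>8 * \<tau> \<le> \<alpha>\<close>, and \<open>1 \<le> n\<close> makes the order
    positive.\<close>
  have factor: "\<exists>H :: 'a pair_pre_digraph. factor_of r H G"
    if \<tau>: "0 < \<tau> \<and> \<tau> \<le> \<alpha> / 8" and \<nu>: "0 < \<nu> \<and> \<nu> \<le> 1" and \<eta>: "\<eta> > 0"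
      and \<gamma>: "\<gamma> = Min {\<eta>, \<alpha> / 2, \<eta> * \<nu>\<^sup>2 / 2, \<eta> * \<tau> / 2}" and n: "1 \<le> n"
      and *: "oriented_graph G \<and> card (pverts G) = n \<and>
       (\<forall>v \<in> pverts G.
          real (out_degree (with_proj G) v) \<in> {(\<alpha> - \<gamma>) * real n <..< (\<alpha> + \<gamma>) * real n} \<and>
          real (in_degree (with_proj G) v) \<in> {(\<alpha> - \<gamma>) * real n <..< (\<alpha> + \<gamma>) * real n}) \<and>
       robust_outexpander \<nu> \<tau> G \<and>
       real r = (\<alpha> - \<eta>) * real n"
    for \<tau> \<nu> \<eta> \<gamma> n r and G :: "'a pair_pre_digraph"
  proof (rule factor_of_if_cut)
    show "pair_fin_digraph G" using * by (simp add: oriented_graph_iff)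
    then interpret pair_fin_digraph G .
    fix X Y assume XY: "X \<subseteq> pverts G" "Y \<subseteq> pverts G"
    have nbs: "parcs G `` {v} \<inter> pverts G = parcs G `` {v}"
      "(parcs G)\<inverse> `` {v} \<inter> pverts G = (parcs G)\<inverse> `` {v}" for v
      using arc_fst_in_verts arc_snd_in_verts by fastforce+
    have "\<gamma> \<le> c" if "c \<in> {\<eta>, \<alpha> / 2, \<eta> * \<nu>\<^sup>2 / 2, \<eta> * \<tau> / 2}" for c
      unfolding \<gamma> using that by (intro Min_le) auto
    from this[of \<eta>] this[of "\<alpha> / 2"] this[of "\<eta> * \<nu>\<^sup>2 / 2"] this[of "\<eta> * \<tau> / 2"]
    have "\<gamma> \<le> \<eta>" "2 * \<gamma> \<le> \<alpha>" "2 * \<gamma> \<le> \<eta> * \<nu>\<^sup>2" "2 * \<gamma> \<le> \<eta> * \<tau>"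
      by auto
    moreover have "0 < \<gamma>"
      unfolding \<gamma> using \<alpha> \<tau> \<nu> \<eta> by simp
    ultimately have "real r * (real (card X) - real (card Y)) \<le> card (parcs G \<inter> X \<times> (pverts G - Y))"
      using * \<alpha> \<tau> \<nu> \<eta> n XY
      by (intro robust_outexpander_cut[where \<alpha> = \<alpha> and \<gamma> = \<gamma> and \<eta> = \<eta> and \<nu> = \<nu> and \<tau> = \<tau>])
        (auto simp: nbs degree_pair_digraph less_imp_le)
    then have "real_of_int (int r * int (card X)) \<le>
        real_of_int (int r * int (card Y) + int (card (parcs G \<inter> X \<times> (pverts G - Y))))"
      by (simp add: algebra_simps)
    then show "int r * int (card X) \<le>
        int r * int (card Y) + int (card (parcs G \<inter> X \<times> (pverts G - Y)))"
      by (simp only: of_int_le_iff)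
  qed
  have pos: "0 < Min {\<eta>, \<alpha> / 2, \<eta> * \<nu>\<^sup>2 / 2, \<eta> * \<tau> / 2}" if "0 < \<tau>" "0 < \<nu>" "0 < \<eta>" for \<tau> \<nu> \<eta>
    using that \<alpha> by simp
  show "\<exists>\<tau>\<^sub>0::real. \<tau>\<^sub>0 > 0 \<and> (\<forall>\<tau>::real. 0 < \<tau> \<and> \<tau> \<le> \<tau>\<^sub>0 \<longrightarrow>
    (\<exists>\<nu>\<^sub>0::real. \<nu>\<^sub>0 > 0 \<and> (\<forall>\<nu>::real. 0 < \<nu> \<and> \<nu> \<le> \<nu>\<^sub>0 \<longrightarrow>
    (\<forall>\<eta>::real. \<eta> > 0 \<longrightarrow>
    (\<exists>\<gamma>::real. \<gamma> > 0 \<and> (\<exists>n\<^sub>0::nat. \<forall>n::nat. n \<ge> n\<^sub>0 \<longrightarrow>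
    (\<forall>(G :: 'a pair_pre_digraph) (r::nat).
       oriented_graph G \<and> card (pverts G) = n \<and>
       (\<forall>v \<in> pverts G.
          real (out_degree (with_proj G) v) \<in> {(\<alpha> - \<gamma>) * real n <..< (\<alpha> + \<gamma>) * real n} \<and>
          real (in_degree (with_proj G) v) \<in> {(\<alpha> - \<gamma>) * real n <..< (\<alpha> + \<gamma>) * real n}) \<and>
       robust_outexpander \<nu> \<tau> G \<and>
       real r = (\<alpha> - \<eta>) * real n \<longrightarrow>
       (\<exists>H :: 'a pair_pre_digraph. factor_of r H G))))))))"
  proof (rule exI[of _ "\<alpha> / 8"], intro conjI allI impI, goal_cases)
    case 1
    then show ?case using \<alpha> by simp
  next
    case (2 \<tau>)
    show ?case
    proof (rule exI[of _ 1], intro conjI allI impI, goal_cases)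
      case 1
      show ?case by simp
    next
      case (2 \<nu> \<eta>)
      show ?case
      proof (rule exI[of _ "Min {\<eta>, \<alpha> / 2, \<eta> * \<nu>\<^sup>2 / 2, \<eta> * \<tau> / 2}"], rule conjI, goal_cases)
        case 1
        show ?case using pos 2 \<open>0 < \<tau> \<and> \<tau> \<le> \<alpha> / 8\<close> by blast
      next
        case 2
        show ?case
          by (rule exI[of _ 1], intro allI impI,
            rule factor[OF \<open>0 < \<tau> \<and> \<tau> \<le> \<alpha> / 8\<close> \<open>0 < \<nu> \<and> \<nu> \<le> 1\<close> \<open>0 < \<eta>\<close> refl])
      qed
    qed
  qed
qed

end
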